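(* Let $n<N$ be positive integers with $n$ odd, and let $\Omega$ be the $n\times N$ matrix with entries ($1\le i\le n$, $1\le j\le N$) $$\Omega_{ij}=\begin{cases}\cos\left(\frac{\pi(j-1)(i-1)}{N}\right), & i=1,3,5,\ldots,n,\\ \sin\left(\frac{\pi(j-1)i}{N}\right), & i=2,4,6,\ldots,n-1.\end{cases}$$ Then $$f_k(\Omega\mathbb{R}_+^N)=f_k(\mathbb{R}_+^N),\qquad k=0,1,\dots,\tfrac12(n-1).$$
   Context: $\mathbb{R}_+^N=\{x\in\mathbb{R}^N: x_i\ge 0\ \forall i\}$. For a polyhedron $Q$, $f_k(Q)$ denotes the number of $k$-dimensional faces of $Q$; $\Omega Q$ is the image of $Q$ under $\Omega$. *)

theory Defs
  imports "HOL-Analysis.Analysis"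
begin

definition nonneg_orthant :: "(real ^ 'N) set" where
  "nonneg_orthant = {x. \<forall>i. 0 \<le> x $ i}"

(* face_of also admits the empty set (of affine dimension -1), which is never counted here
   because k is a natural number, and Q itself, which counts as a face of dimension aff_dim Q. *)
definition num_faces :: "nat \<Rightarrow> 'a::euclidean_space set \<Rightarrow> nat" where
  "num_faces k Q = card {F. F face_of Q \<and> aff_dim F = int k}"

(* The indices i and j start at 1. *)
definition trig_entry :: "nat \<Rightarrow> nat \<Rightarrow> nat \<Rightarrow> real" where
  "trig_entry N i j =
     (if odd i then cos (pi * (real j - 1) * (real i - 1) / real N)
      else sin (pi * (real j - 1) * real i / real N))"

(* A matrix of type real ^ 'N ^ 'n has unordered index types. The bijections rix and cix number
   the rows by 1, ..., n and the columns by 1, ..., N; in particular they force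
   CARD('n) = n and CARD('N) = N. *)
definition is_trig_matrix ::
  "nat \<Rightarrow> nat \<Rightarrow> (nat \<Rightarrow> 'n) \<Rightarrow> (nat \<Rightarrow> 'N) \<Rightarrow> real ^ 'N ^ 'n \<Rightarrow> bool" where
  "is_trig_matrix n N rix cix \<Omega> \<longleftrightarrow>
     bij_betw rix {1..n} UNIV \<and> bij_betw cix {1..N} UNIV \<and>
     (\<forall>i\<in>{1..n}. \<forall>j\<in>{1..N}. \<Omega> $ rix i $ cix j = trig_entry N i j)"

end

(* The columns of Omega are the points (1, sin t, cos t, sin 2t, cos 2t, ...) at the N distinct
   nodes t_j = 2 pi (j - 1) / N, so linear functionals on the columns are trigonometric polynomials
   of degree at most (n - 1) / 2. For a set S of at most (n - 1) / 2 columns, the product over S of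
   1 - cos (t - t_s) is such a polynomial; it vanishes at S and is positive at all other nodes.
   Hence every such S spans an exposed face of the cone generated by the columns. Conversely, since
   removing one element from S gives a functional separating it from the others, any
   (n - 1) / 2 + 1 columns are linearly independent, and so every face of dimension
   k <= (n - 1) / 2 is generated by exactly k columns. Thus the k-faces correspond to the k-subsets
   of the columns. The orthant is the same situation for the identity matrix. *)
theory Submission imports Defs begin

section \<open>Finitely generated convex cones\<close>

definition gen_cone :: "('i \<Rightarrow> 'a::real_vector) \<Rightarrow> 'i set \<Rightarrow> 'a set" where
  "gen_cone v T = {\<Sum>j\<in>T. a j *\<^sub>R v j | a. \<forall>j\<in>T. 0 \<le> a j}"

(* Meant for a finite index type: infinite sets have card 0. *)
definition neighborly :: "nat \<Rightarrow> ('i \<Rightarrow> 'a::real_inner) \<Rightarrow> bool" where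
  "neighborly m v \<longleftrightarrow>
     (\<forall>S. card S \<le> m \<longrightarrow> (\<exists>c. (\<forall>j\<in>S. c \<bullet> v j = 0) \<and> (\<forall>j. j \<notin> S \<longrightarrow> 0 < c \<bullet> v j)))"

lemma gen_coneI: "(\<And>j. j \<in> T \<Longrightarrow> 0 \<le> a j) \<Longrightarrow> (\<Sum>j\<in>T. a j *\<^sub>R v j) \<in> gen_cone v T"
  by (auto simp: gen_cone_def)

lemma zero_in_gen_cone: "0 \<in> gen_cone v T"
  using gen_coneI[of T "\<lambda>_. 0" v] by simp

lemma generator_in_gen_cone:
  assumes "finite T" "j \<in> T"
  shows "v j \<in> gen_cone v T"
proof -
  have "(\<Sum>i\<in>T. (if i = j then 1 else 0) *\<^sub>R v i) = (\<Sum>i\<in>T. if i = j then v j else 0)"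
    by (rule sum.cong) auto
  also have "\<dots> = v j"
    using assms by simp
  finally show ?thesis
    using gen_coneI[of T "\<lambda>i. if i = j then 1 else 0" v] by simp
qed

lemma gen_cone_mono:
  assumes "finite T" "S \<subseteq> T"
  shows "gen_cone v S \<subseteq> gen_cone v T"
proof
  fix x assume "x \<in> gen_cone v S"
  then obtain a where a: "x = (\<Sum>j\<in>S. a j *\<^sub>R v j)" "\<forall>j\<in>S. 0 \<le> a j"
    by (auto simp: gen_cone_def)
  have "x = (\<Sum>j\<in>T. (if j \<in> S then a j else 0) *\<^sub>R v j)"
    unfolding a(1) using assms by (intro sum.mono_neutral_cong_left) auto
  then show "x \<in> gen_cone v T"
    using a(2) gen_coneI[of T "\<lambda>j. if j \<in> S then a j else 0" v] by simp
qed

lemma convex_gen_cone: "convex (gen_cone v T)"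
proof (rule convexI)
  fix x y and s t :: real
  assume "x \<in> gen_cone v T" "y \<in> gen_cone v T" and st: "0 \<le> s" "0 \<le> t"
  then obtain a b where "x = (\<Sum>j\<in>T. a j *\<^sub>R v j)" "\<forall>j\<in>T. 0 \<le> a j"
    "y = (\<Sum>j\<in>T. b j *\<^sub>R v j)" "\<forall>j\<in>T. 0 \<le> b j"
    by (auto simp: gen_cone_def)
  moreover from this have "s *\<^sub>R x + t *\<^sub>R y = (\<Sum>j\<in>T. (s * a j + t * b j) *\<^sub>R v j)"
    by (simp add: scaleR_sum_right sum.distrib scaleR_add_left)
  ultimately show "s *\<^sub>R x + t *\<^sub>R y \<in> gen_cone v T"
    using st by (auto intro!: gen_coneI)
qed

lemma conic_gen_cone: "conic (gen_cone v T)"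
proof (unfold conic_def, intro allI impI)
  fix x and t :: real
  assume "x \<in> gen_cone v T" and t: "0 \<le> t"
  then obtain a where "x = (\<Sum>j\<in>T. a j *\<^sub>R v j)" "\<forall>j\<in>T. 0 \<le> a j"
    by (auto simp: gen_cone_def)
  moreover from this have "t *\<^sub>R x = (\<Sum>j\<in>T. (t * a j) *\<^sub>R v j)"
    by (simp add: scaleR_sum_right)
  ultimately show "t *\<^sub>R x \<in> gen_cone v T"
    using t by (auto intro!: gen_coneI)
qed

text \<open>Twice the midpoint of two points is their sum, so a convex cone is closed under
  addition, and all nonnegative combinations of its elements stay inside it.\<close>

lemma gen_cone_subset:
  assumes "finite T" "convex F" "conic F" "0 \<in> F" "\<And>j. j \<in> T \<Longrightarrow> v j \<in> F"
  shows "gen_cone v T \<subseteq> F"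
proof
  fix x assume "x \<in> gen_cone v T"
  then obtain a where a: "x = (\<Sum>j\<in>T. a j *\<^sub>R v j)" "\<forall>j\<in>T. 0 \<le> a j"
    by (auto simp: gen_cone_def)
  have add: "y + z \<in> F" if "y \<in> F" "z \<in> F" for y z
  proof -
    have "2 *\<^sub>R ((1/2) *\<^sub>R y + (1/2) *\<^sub>R z) \<in> F"
      using assms(2,3) that by (intro conicD convexD) auto
    then show ?thesis
      by (simp add: scaleR_add_right)
  qed
  have "(\<Sum>j\<in>S. a j *\<^sub>R v j) \<in> F" if "finite S" "S \<subseteq> T" for S
    using that
  proof (induction S)
    case (insert j S)
    then show ?case
      using a(2) assms(3,5) by (auto intro!: add conicD)
  qed (use assms(4) in simp)
  then show "x \<in> F"
    using a(1) assms(1) by simp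
qed

lemma span_gen_cone:
  assumes "finite T"
  shows "span (gen_cone v T) = span (v ` T)"
proof (rule span_eq[THEN iffD2], intro conjI)
  show "gen_cone v T \<subseteq> span (v ` T)"
    by (auto simp: gen_cone_def intro!: span_sum span_scale intro: span_base)
  show "v ` T \<subseteq> span (gen_cone v T)"
    using generator_in_gen_cone[OF assms] by (auto intro: span_base)
qed

lemma aff_dim_gen_cone:
  fixes v :: "'i \<Rightarrow> 'a::euclidean_space"
  assumes "finite T"
  shows "aff_dim (gen_cone v T) = int (dim (v ` T))"
proof -
  have "aff_dim (gen_cone v T) = int (dim (gen_cone v T))"
    by (intro aff_dim_zero hull_inc zero_in_gen_cone)
  then show ?thesis
    by (metis assms dim_span span_gen_cone)
qed

section \<open>Faces of generated cones\<close>

text \<open>If a point of the face uses \<open>v j\<close> with a positive coefficient, the point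
  lies between a positive multiple of \<open>v j\<close> and another point of the cone. The face
  then contains that multiple and, being a cone itself, also \<open>v j\<close>.\<close>

lemma face_of_gen_cone_eq:
  fixes v :: "'i::finite \<Rightarrow> 'a::euclidean_space"
  assumes F: "F face_of gen_cone v UNIV" and "F \<noteq> {}"
  shows "F = gen_cone v {j. v j \<in> F}"
proof
  have cF: "conic F"
    using F face_of_conic conic_gen_cone by blast
  have zF: "0 \<in> F"
    using cF \<open>F \<noteq> {}\<close> by (simp add: conic_contains_0)
  show "gen_cone v {j. v j \<in> F} \<subseteq> F"
    using F cF zF by (intro gen_cone_subset) (auto dest: face_of_imp_convex)
  show "F \<subseteq> gen_cone v {j. v j \<in> F}"
  proof
    fix x assume x: "x \<in> F"
    then obtain a where a: "x = (\<Sum>j\<in>UNIV. a j *\<^sub>R v j)" "\<And>j. 0 \<le> a j"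
      using F face_of_imp_subset by (fastforce simp: gen_cone_def)
    have "v j \<in> F" if "a j \<noteq> 0" for j
    proof -
      \<comment> \<open>The factors 2 make \<open>x\<close> the midpoint of \<open>y\<close> and
        \<open>z\<close>.\<close>
      define y where "y = (2 * a j) *\<^sub>R v j"
      define z where "z = 2 *\<^sub>R (\<Sum>i\<in>UNIV - {j}. a i *\<^sub>R v i)"
      have xyz: "x = (1/2) *\<^sub>R (y + z)"
        unfolding y_def z_def a(1)
        by (subst sum.remove[of _ j]) (auto simp: scaleR_add_right)
      have gz: "z \<in> gen_cone v UNIV"
        unfolding z_def using gen_cone_mono[of UNIV "UNIV - {j}" v]
        by (intro conicD[OF conic_gen_cone]) (auto intro!: gen_coneI a(2))
      have gy: "y \<in> gen_cone v UNIV"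
        unfolding y_def using a(2)[of j]
        by (intro conicD[OF conic_gen_cone] generator_in_gen_cone) auto
      have yF: "y \<in> F"
      \<comment> \<open>For \<open>y = z\<close> the open segment is empty and the defining property
        of a face gives nothing, but then both points coincide with \<open>x\<close>.\<close>
      proof (cases "y = z")
        case True
        then have "y = x"
          using xyz by (simp flip: scaleR_2)
        then show ?thesis
          using x by simp
      next
        case False
        then have "x \<in> open_segment y z"
          using xyz by (auto simp: in_segment intro!: exI[of _ "1/2"] simp: scaleR_add_right)
        then show ?thesis
          using face_ofD[OF F] gy gz x by blast
      qed
      have "v j = (1 / (2 * a j)) *\<^sub>R y"
        using that by (simp add: y_def)
      also have "\<dots> \<in> F"
        using a(2)[of j] by (intro conicD[OF cF yF]) auto
      finally show ?thesis .
    qed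
    then have "x = (\<Sum>j\<in>{j. v j \<in> F}. a j *\<^sub>R v j)"
      unfolding a(1) by (intro sum.mono_neutral_right) auto
    then show "x \<in> gen_cone v {j. v j \<in> F}"
      using a(2) by (simp add: gen_coneI)
  qed
qed

section \<open>Neighborly families: faces, independence and face counts\<close>

text \<open>The functional \<open>c\<close> is nonnegative on the cone. Where it vanishes on a
  nonnegative combination, it vanishes on each term, so only generators from \<open>S\<close> can
  have nonzero coefficients. The second claim recovers \<open>S\<close> from its face, so different
  sets give different faces.\<close>

lemma neighborly_face:
  fixes v :: "'i::finite \<Rightarrow> 'a::euclidean_space"
  assumes "neighborly m v" "card S \<le> m"
  shows "gen_cone v S face_of gen_cone v UNIV" "{j. v j \<in> gen_cone v S} = S"
proof -
  obtain c where c: "\<And>j. j \<in> S \<Longrightarrow> c \<bullet> v j = 0" "\<And>j. j \<notin> S \<Longrightarrow> 0 < c \<bullet> v j"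
    using assms unfolding neighborly_def by blast
  have nonneg: "0 \<le> c \<bullet> v j" for j
    using c[of j] by (cases "j \<in> S") auto
  have zero: "c \<bullet> x = 0" if "x \<in> gen_cone v S" for x
    using that c(1) by (auto simp: gen_cone_def inner_sum_right)
  have eq: "gen_cone v S = gen_cone v UNIV \<inter> {x. c \<bullet> x = 0}"
  proof
    show "gen_cone v S \<subseteq> gen_cone v UNIV \<inter> {x. c \<bullet> x = 0}"
      using gen_cone_mono[of UNIV S v] zero by auto
    show "gen_cone v UNIV \<inter> {x. c \<bullet> x = 0} \<subseteq> gen_cone v S"
    proof
      fix x assume x: "x \<in> gen_cone v UNIV \<inter> {x. c \<bullet> x = 0}"
      then obtain a where a: "x = (\<Sum>j\<in>UNIV. a j *\<^sub>R v j)" "\<And>j. 0 \<le> a j"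
        by (auto simp: gen_cone_def)
      have "(\<Sum>j\<in>UNIV. a j * (c \<bullet> v j)) = 0"
        using x a(1) by (simp add: inner_sum_right)
      then have "a j * (c \<bullet> v j) = 0" for j
        using a(2) nonneg by (subst (asm) sum_nonneg_eq_0_iff) auto
      then have "a j = 0" if "j \<notin> S" for j
        using c(2)[OF that] by (metis less_irrefl mult_eq_0_iff)
      then have "x = (\<Sum>j\<in>S. a j *\<^sub>R v j)"
        unfolding a(1) by (intro sum.mono_neutral_right) auto
      then show "x \<in> gen_cone v S"
        using a(2) by (simp add: gen_coneI)
    qed
  qed
  show "gen_cone v S face_of gen_cone v UNIV"
    unfolding eq
  proof (rule face_of_Int_supporting_hyperplane_ge[OF convex_gen_cone])
    show "c \<bullet> x \<ge> 0" if "x \<in> gen_cone v UNIV" for x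
      using that nonneg by (auto simp: gen_cone_def inner_sum_right intro!: sum_nonneg)
  qed
  show "{j. v j \<in> gen_cone v S} = S"
    using c(2) zero generator_in_gen_cone[of S] by fastforce
qed

text \<open>The bound is \<open>Suc m\<close> because neighborliness is applied to \<open>S\<close>
  without one element \<open>s\<close>: the functional vanishes at all the others but is positive at
  \<open>v s\<close>, which keeps \<open>v s\<close> out of their span.\<close>

lemma neighborly_independent:
  fixes v :: "'i::finite \<Rightarrow> 'a::euclidean_space"
  assumes "neighborly m v" "card S \<le> Suc m"
  shows "independent (v ` S)" "inj_on v S"
proof -
  have sep: "\<exists>c. c \<bullet> v s \<noteq> 0 \<and> (\<forall>j\<in>S - {s}. c \<bullet> v j = 0)" if "s \<in> S" for s
  proof -
    have "card (S - {s}) \<le> m"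
      using assms(2) that by simp
    then obtain c where "\<forall>j\<in>S - {s}. c \<bullet> v j = 0" "\<forall>j. j \<notin> S - {s} \<longrightarrow> 0 < c \<bullet> v j"
      using assms(1) unfolding neighborly_def by blast
    then show ?thesis
      by (metis Diff_iff insertI1 less_irrefl)
  qed
  show "inj_on v S"
  proof (rule inj_onI, rule ccontr)
    fix i j assume "i \<in> S" "j \<in> S" "v i = v j" "i \<noteq> j"
    then show False
      using sep[of i] by auto
  qed
  show "independent (v ` S)"
    unfolding dependent_def
  proof safe
    fix s assume s: "s \<in> S" "v s \<in> span (v ` S - {v s})"
    obtain c where c: "c \<bullet> v s \<noteq> 0" "\<And>j. j \<in> S - {s} \<Longrightarrow> c \<bullet> v j = 0"
      using sep[OF s(1)] by blast
    have "orthogonal c (v s)"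
      using c(2) by (intro orthogonal_to_span[OF s(2)]) (auto simp: orthogonal_def)
    then show False
      using c(1) by (simp add: orthogonal_def)
  qed
qed

lemma neighborly_dim:
  fixes v :: "'i::finite \<Rightarrow> 'a::euclidean_space"
  assumes "neighborly m v" "card S \<le> Suc m"
  shows "dim (v ` S) = card S"
  using neighborly_independent[OF assms] by (simp add: dim_eq_card_independent card_image)

text \<open>Mapping a face to the indices of the generators it contains, and an index set to the
  cone it generates, gives mutually inverse bijections.\<close>

lemma num_faces_neighborly:
  fixes v :: "'i::finite \<Rightarrow> 'a::euclidean_space"
  assumes nb: "neighborly m v" and k: "k \<le> m"
  shows "num_faces k (gen_cone v UNIV) = card {S :: 'i set. card S = k}"
  unfolding num_faces_def
proof (rule bij_betw_same_card[of "\<lambda>F. {j. v j \<in> F}"],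
       rule bij_betw_byWitness[where f' = "gen_cone v"])
  \<comment> \<open>The empty face has affine dimension -1, so it is excluded by
    \<open>aff_dim F = int k\<close>.\<close>
  have eq: "F = gen_cone v {j. v j \<in> F}" if "F face_of gen_cone v UNIV" "aff_dim F = int k" for F
    using that by (intro face_of_gen_cone_eq) auto
  show "\<forall>F\<in>{F. F face_of gen_cone v UNIV \<and> aff_dim F = int k}. gen_cone v {j. v j \<in> F} = F"
    using eq by auto
  show "\<forall>S\<in>{S. card S = k}. {j. v j \<in> gen_cone v S} = S"
    using neighborly_face(2)[OF nb] k by simp
  show "gen_cone v ` {S. card S = k} \<subseteq> {F. F face_of gen_cone v UNIV \<and> aff_dim F = int k}"
    using neighborly_face(1)[OF nb] k by (auto simp: aff_dim_gen_cone neighborly_dim[OF nb])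
  show "(\<lambda>F. {j. v j \<in> F}) ` {F. F face_of gen_cone v UNIV \<and> aff_dim F = int k}
        \<subseteq> {S. card S = k}"
  proof safe
    fix F assume F: "F face_of gen_cone v UNIV" "aff_dim F = int k"
    let ?T = "{j. v j \<in> F}"
    have "aff_dim F = int (dim (v ` ?T))"
      using aff_dim_gen_cone[of ?T v] eq[OF F] by simp
    then have dimT: "dim (v ` ?T) = k"
      using F(2) by simp
    have "card ?T \<le> m"
    \<comment> \<open>Otherwise \<open>Suc m\<close> of the generators in the face are independent,
      and its dimension exceeds \<open>m\<close>, hence \<open>k\<close>.\<close>
    proof (rule ccontr)
      assume "\<not> card ?T \<le> m"
      then obtain U where U: "U \<subseteq> ?T" "card U = Suc m"
        by (metis not_less_eq_eq obtain_subset_with_card_n)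
      have "dim (v ` U) \<le> dim (v ` ?T)"
        using U(1) by (intro dim_subset image_mono)
      then show False
        using U(2) neighborly_dim[OF nb, of U] dimT k by simp
    qed
    then show "card ?T = k"
      using neighborly_dim[OF nb, of ?T] dimT by simp
  qed
qed

section \<open>The orthant and its linear images\<close>

lemma matrix_image_nonneg_orthant:
  "(\<lambda>x. A *v x) ` nonneg_orthant = gen_cone (\<lambda>j. column j A) UNIV"
proof -
  have "(\<lambda>x. A *v x) ` nonneg_orthant = {A *v x | x. \<forall>j. 0 \<le> x $ j}"
    by (auto simp: nonneg_orthant_def)
  also have "\<dots> = {A *v (\<chi> j. a j) | a. \<forall>j. 0 \<le> a j}"
    by (metis (no_types, lifting) vec_lambda_beta vec_nth_inverse)
  finally show ?thesis
    by (simp add: gen_cone_def matrix_mult_sum scalar_mult_eq_scaleR)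
qed

text \<open>The indicator vector of the complement of \<open>S\<close> serves as functional, for
  every \<open>m\<close>. This makes the face count available for the orthant itself.\<close>

lemma neighborly_mat_1: "neighborly m (\<lambda>j. column j (mat 1 :: real^'N^'N))"
proof -
  have col: "column j (mat 1 :: real^'N^'N) = axis j 1" for j
    by (simp add: vec_eq_iff column_def mat_def axis_def)
  have "\<exists>c :: real^'N. (\<forall>j\<in>S. c \<bullet> axis j 1 = 0) \<and> (\<forall>j. j \<notin> S \<longrightarrow> 0 < c \<bullet> axis j 1)" for S
    by (intro exI[of _ "\<chi> j. if j \<in> S then 0 else 1"]) (simp add: inner_axis)
  then show ?thesis
    by (simp add: neighborly_def col)
qed

section \<open>Trigonometric polynomials\<close>

text \<open>Real trigonometric polynomials of degree at most \<open>d\<close>; constants arise from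
  the cosine with \<open>r = 0\<close>. The inductive form lets linear properties be proved on the
  basis functions and carried through sums and multiples.\<close>

inductive trig_poly :: "nat \<Rightarrow> (real \<Rightarrow> real) \<Rightarrow> bool" for d where
  cos: "r \<le> d \<Longrightarrow> trig_poly d (\<lambda>x. cos (real r * x))"
| sin: "r \<le> d \<Longrightarrow> trig_poly d (\<lambda>x. sin (real r * x))"
| add: "trig_poly d f \<Longrightarrow> trig_poly d g \<Longrightarrow> trig_poly d (\<lambda>x. f x + g x)"
| scale: "trig_poly d f \<Longrightarrow> trig_poly d (\<lambda>x. a * f x)"

lemma trig_poly_mono: "trig_poly d f \<Longrightarrow> d \<le> e \<Longrightarrow> trig_poly e f"
  by (induction rule: trig_poly.induct) (auto intro: trig_poly.intros)

text \<open>The product-to-sum formulas turn a product with frequency \<open>r\<close> into terms of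
  frequencies \<open>r + 1\<close> and \<open>r - 1\<close>.\<close>

lemma trig_poly_mult_cos_sin:
  assumes "trig_poly d f"
  shows "trig_poly (Suc d) (\<lambda>x. f x * cos x) \<and> trig_poly (Suc d) (\<lambda>x. f x * sin x)"
  using assms
proof (induction rule: trig_poly.induct)
  case (cos r)
  note intros = trig_poly.intros(3)[OF trig_poly.intros(4) trig_poly.intros(4)]
  show ?case
  \<comment> \<open>Frequency 0 is separate, since \<open>r - 1\<close> must be a natural
    number.\<close>
  proof (cases r)
    case 0
    then show ?thesis
      using trig_poly.cos[of 1 "Suc d"] trig_poly.sin[of 1 "Suc d"] by simp
  next
    case (Suc q)
    have shift: "real (Suc r) * x = real r * x + x" "real q * x = real r * x - x" for x
      by (simp_all add: Suc algebra_simps)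
    have "cos (real r * x) * cos x = 1/2 * cos (real (Suc r) * x) + 1/2 * cos (real q * x)"
      "cos (real r * x) * sin x = 1/2 * sin (real (Suc r) * x) + (- 1/2) * sin (real q * x)" for x
      unfolding shift cos_add sin_add cos_diff sin_diff by (simp_all add: field_simps)
    then show ?thesis
      using cos Suc by (simp only:) (intro conjI intros trig_poly.cos trig_poly.sin; simp)
  qed
next
  case (sin r)
  note intros = trig_poly.intros(3)[OF trig_poly.intros(4) trig_poly.intros(4)]
  show ?case
  proof (cases r)
    case 0
    then show ?thesis
      using trig_poly.sin[of 0 "Suc d"] by simp
  next
    case (Suc q)
    have shift: "real (Suc r) * x = real r * x + x" "real q * x = real r * x - x" for x
      by (simp_all add: Suc algebra_simps)
    have "sin (real r * x) * cos x = 1/2 * sin (real (Suc r) * x) + 1/2 * sin (real q * x)"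
      "sin (real r * x) * sin x = 1/2 * cos (real q * x) + (- 1/2) * cos (real (Suc r) * x)" for x
      unfolding shift cos_add sin_add cos_diff sin_diff by (simp_all add: field_simps)
    then show ?thesis
      using sin Suc by (simp only:) (intro conjI intros trig_poly.cos trig_poly.sin; simp)
  qed
next
  case (add f g)
  then show ?case
    by (auto simp: distrib_right intro: trig_poly.add)
next
  case (scale f a)
  then show ?case
    by (auto simp: mult.assoc intro: trig_poly.scale)
qed

text \<open>By the addition formula each factor is a combination of 1, \<open>cos x\<close> and
  \<open>sin x\<close>, so it raises the degree by at most one.\<close>

lemma trig_poly_prod:
  assumes "finite S"
  shows "trig_poly (card S) (\<lambda>x. \<Prod>s\<in>S. 1 - cos (x - t s))"
  using assms
proof (induction S)
  case empty
  then show ?case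
    using trig_poly.cos[of 0 0] by simp
next
  case (insert s S)
  let ?f = "\<lambda>x. \<Prod>s\<in>S. 1 - cos (x - t s)"
  have "trig_poly (Suc (card S))
      (\<lambda>x. ?f x + ((- cos (t s)) * (?f x * cos x) + (- sin (t s)) * (?f x * sin x)))"
    using trig_poly_mult_cos_sin[OF insert.IH] trig_poly_mono[OF insert.IH, of "Suc (card S)"]
    by (intro trig_poly.add trig_poly.scale) auto
  also have "(\<lambda>x. ?f x + ((- cos (t s)) * (?f x * cos x) + (- sin (t s)) * (?f x * sin x)))
      = (\<lambda>x. \<Prod>s\<in>insert s S. 1 - cos (x - t s))"
    using insert.hyps by (auto simp: fun_eq_iff cos_diff algebra_simps)
  finally show ?case
    using insert.hyps by simp
qed

section \<open>Functionals on the columns of the trigonometric matrix\<close>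

text \<open>At the nodes, row \<open>2 * r + 1\<close> holds the values of the cosine of frequency
  \<open>r\<close>, and row \<open>2 * r\<close> those of the sine. The condition
  \<open>2 * d < n\<close> ensures that row \<open>2 * d + 1\<close> exists.\<close>

lemma trig_poly_realizable:
  fixes \<Omega> :: "real ^ 'N ^ 'n"
  assumes \<Omega>: "is_trig_matrix n N rix cix \<Omega>" and "trig_poly d f" and "2 * d < n"
  shows "\<exists>c. \<forall>j\<in>{1..N}. c \<bullet> column (cix j) \<Omega> = f (2 * pi * (real j - 1) / real N)"
  using assms(2,3)
proof (induction rule: trig_poly.induct)
  case (cos r)
  have "\<forall>j\<in>{1..N}. axis (rix (2 * r + 1)) 1 \<bullet> column (cix j) \<Omega>
      = cos (real r * (2 * pi * (real j - 1) / real N))"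
    using \<Omega> cos by (auto simp: is_trig_matrix_def inner_axis' column_def trig_entry_def mult_ac)
  then show ?case ..
next
  case (sin r)
  \<comment> \<open>There is no row 0, but the sine of frequency 0 vanishes identically, so the zero
    functional realizes it.\<close>
  show ?case
  proof (cases "r = 0")
    case True
    then show ?thesis
      by (auto intro: exI[of _ 0])
  next
    case False
    then have "\<forall>j\<in>{1..N}. axis (rix (2 * r)) 1 \<bullet> column (cix j) \<Omega>
        = sin (real r * (2 * pi * (real j - 1) / real N))"
      using \<Omega> sin by (auto simp: is_trig_matrix_def inner_axis' column_def trig_entry_def mult_ac)
    then show ?thesis ..
  qed
next
  case (add f g)
  then obtain c c' where
    "\<forall>j\<in>{1..N}. c \<bullet> column (cix j) \<Omega> = f (2 * pi * (real j - 1) / real N)"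
    "\<forall>j\<in>{1..N}. c' \<bullet> column (cix j) \<Omega> = g (2 * pi * (real j - 1) / real N)"
    by blast
  then show ?case
    by (intro exI[of _ "c + c'"]) (simp add: inner_add_left)
next
  case (scale f a)
  then obtain c where
    "\<forall>j\<in>{1..N}. c \<bullet> column (cix j) \<Omega> = f (2 * pi * (real j - 1) / real N)"
    by blast
  then show ?case
    by (intro exI[of _ "a *\<^sub>R c"]) simp
qed

text \<open>Equality would make the nodes agree modulo \<open>2 * pi\<close>, so that
  \<open>N\<close> divides the nonzero difference \<open>i - j\<close>, whose absolute value is
  below \<open>N\<close>.\<close>

lemma cos_node_diff_less_1:
  assumes "i \<in> {1..N}" "j \<in> {1..N}" "i \<noteq> j"
  shows "cos (2 * pi * (real i - 1) / real N - 2 * pi * (real j - 1) / real N) < 1"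
proof -
  have N: "real N > 0"
    using assms by auto
  have "cos (2 * pi * (real i - 1) / real N - 2 * pi * (real j - 1) / real N) \<noteq> 1"
  proof
    assume "cos (2 * pi * (real i - 1) / real N - 2 * pi * (real j - 1) / real N) = 1"
    then obtain q :: int where q:
      "2 * pi * (real i - 1) / real N - 2 * pi * (real j - 1) / real N = of_int q * 2 * pi"
      by (auto simp: cos_one_2pi_int)
    have "2 * pi * (real i - real j)
        = (2 * pi * (real i - 1) / real N - 2 * pi * (real j - 1) / real N) * real N"
      using N by (simp add: field_simps)
    also have "\<dots> = 2 * pi * (of_int q * real N)"
      unfolding q by simp
    finally have "real i - real j = of_int q * real N"
      by simp
    then have "int i - int j = q * int N"
      by (metis of_int_diff of_int_eq_iff of_int_mult of_int_of_nat_eq)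
    then have "int N dvd int i - int j"
      by simp
    moreover have "\<bar>int i - int j\<bar> < int N" "int i - int j \<noteq> 0"
      using assms by auto
    ultimately show False
      using dvd_imp_le_int[of "int i - int j" "int N"] by simp
  qed
  then show ?thesis
    by (simp add: order_less_le)
qed

lemma neighborly_trig_matrix:
  fixes \<Omega> :: "real ^ 'N ^ 'n"
  assumes \<Omega>: "is_trig_matrix n N rix cix \<Omega>" and m: "2 * m < n"
  shows "neighborly m (\<lambda>l. column l \<Omega>)"
  unfolding neighborly_def
proof (intro allI impI)
  fix S :: "'N set" assume S: "card S \<le> m"
  define node where "node j = 2 * pi * (real j - 1) / real N" for j
  \<comment> \<open>\<open>R\<close> is \<open>S\<close> in the numbering by 1, ...,
    \<open>N\<close>. It has at most as many elements as \<open>S\<close>, which bounds the degree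
    of the product over \<open>R\<close>.\<close>
  define R where "R = {j\<in>{1..N}. cix j \<in> S}"
  have bij: "bij_betw cix {1..N} UNIV"
    using \<Omega> by (simp add: is_trig_matrix_def)
  have "card R \<le> card S"
    using bij unfolding R_def bij_betw_def
    by (intro card_inj_on_le[of cix]) (auto intro: inj_on_subset)
  then have "2 * card R < n"
    using S m by simp
  moreover have "finite R"
    by (simp add: R_def)
  ultimately obtain c where
    "\<forall>j\<in>{1..N}. c \<bullet> column (cix j) \<Omega> = (\<Prod>s\<in>R. 1 - cos (node j - node s))"
    using trig_poly_realizable[OF \<Omega> trig_poly_prod[of R node]] unfolding node_def by blast
  then have c: "c \<bullet> column (cix j) \<Omega> = (\<Prod>s\<in>R. 1 - cos (node j - node s))"
    if "j \<in> {1..N}" for j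
    using that by blast
  have surj: "\<exists>j\<in>{1..N}. l = cix j" for l
    using bij by (metis UNIV_I bij_betw_def imageE)
  have "c \<bullet> column l \<Omega> = 0" if l: "l \<in> S" for l
  proof -
    obtain j where j: "j \<in> {1..N}" "l = cix j"
      using surj by blast
    have "j \<in> R" "finite R"
      using j l by (auto simp: R_def)
    then show ?thesis
      unfolding j(2) c[OF j(1)] by (intro prod_zero) (auto intro: bexI[of _ j])
  qed
  moreover have "0 < c \<bullet> column l \<Omega>" if l: "l \<notin> S" for l
  proof -
    obtain j where j: "j \<in> {1..N}" "l = cix j"
      using surj by blast
    \<comment> \<open>As \<open>l\<close> is outside \<open>S\<close>, its number \<open>j\<close>
      differs from every \<open>s\<close> in \<open>R\<close>, and each factor is positive.\<close>
    have "cos (node j - node s) < 1" if "s \<in> R" for s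
      using cos_node_diff_less_1[OF j(1), of s] that j(2) l by (auto simp: R_def node_def)
    then show ?thesis
      unfolding j(2) c[OF j(1)] by (intro prod_pos) auto
  qed
  ultimately show "\<exists>c. (\<forall>j\<in>S. c \<bullet> column j \<Omega> = 0) \<and> (\<forall>j. j \<notin> S \<longrightarrow> 0 < c \<bullet> column j \<Omega>)"
    by blast
qed

theorem corollary4p1:
  fixes n N k :: nat
    and rix :: "nat \<Rightarrow> 'n::finite" and cix :: "nat \<Rightarrow> 'N::finite"
    and \<Omega> :: "real ^ 'N ^ 'n"
  assumes "0 < n" and "n < N" and "odd n"
    and "is_trig_matrix n N rix cix \<Omega>"
    and "k \<le> (n - 1) div 2"
  shows "num_faces k ((\<lambda>x. \<Omega> *v x) ` nonneg_orthant)
       = num_faces k (nonneg_orthant :: (real ^ 'N) set)"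
proof -
  \<comment> \<open>Neighborliness is taken at \<open>k\<close> itself: \<open>0 < n\<close> and the
    bound on \<open>k\<close> give \<open>2 * k < n\<close>.\<close>
  have "neighborly k (\<lambda>j. column j \<Omega>)"
    using assms(1,5) by (intro neighborly_trig_matrix[OF assms(4)]) auto
  then have "num_faces k ((\<lambda>x. \<Omega> *v x) ` nonneg_orthant) = card {S :: 'N set. card S = k}"
    by (simp add: matrix_image_nonneg_orthant num_faces_neighborly)
  \<comment> \<open>The orthant is its own image under the identity matrix.\<close>
  moreover have "num_faces k (nonneg_orthant :: (real ^ 'N) set) = card {S :: 'N set. card S = k}"
    using num_faces_neighborly[OF neighborly_mat_1[where 'N = 'N] order_refl]
      matrix_image_nonneg_orthant[of "mat 1 :: real^'N^'N"] by simp
  ultimately show ?thesis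
    by simp
qed

end
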